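(* Let $G_3 = \langle g_1, g_2, g_3 \mid g_2g_1 = g_1^{-1}g_2,\ g_3g_1 = g_1^{-1}g_3,\ g_3g_2 = g_1g_2g_3 \rangle$. Set \[ \mathcal{A} = \left\{ \begin{bmatrix} 2k & 2m+1 \\ 2l+1 & 2n \end{bmatrix} \in \mathrm{GL}(2,\mathbb{Z}) : k,l,m,n \in \mathbb{Z} \right\}, \qquad \mathcal{B} = \left\{ \begin{bmatrix} 2k+1 & 2m \\ 2l & 2n+1 \end{bmatrix} \in \mathrm{GL}(2,\mathbb{Z}) : k,l,m,n \in \mathbb{Z} \right\}, \] and for $a \in \mathbb{Z}$, $A \in \mathcal{A}$, $B \in \mathcal{B}$, set (in $1+2$ block form) \[ \alpha_{a,A} = \left[\begin{array}{cc} 1 & \begin{matrix} a & a+1 \end{matrix} \\ \begin{matrix} 0 \\ 0 \end{matrix} & A \end{array}\right], \quad \beta_{a,A} = \left[\begin{array}{cc} -1 & \begin{matrix} a & a \end{matrix} \\ \begin{matrix} 0 \\ 0 \end{matrix} & A \end{array}\right], \quad \gamma_{a,B} = \left[\begin{array}{cc} 1 & \begin{matrix} a & a \end{matrix} \\ \begin{matrix} 0 \\ 0 \end{matrix} & B \end{array}\right], \quad \delta_{a,B} = \left[\begin{array}{cc} -1 & \begin{matrix} a & a-1 \end{matrix} \\ \begin{matrix} 0 \\ 0 \end{matrix} & B \end{array}\right]. \] Then \begin{align*} \mathrm{Aut}(G_3) &= \{ \alpha_{a,A}, \beta_{a,A}, \gamma_{a,B}, \delta_{a,B} \mid a \in \mathbb{Z},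 A \in \mathcal{A}, B \in \mathcal{B} \}, \\ \mathrm{Inn}(G_3) &= \{ \gamma_{a,I_2}, \delta_{a,I_2} \mid a \in \mathbb{Z} \}, \\ \mathrm{Out}(G_3) &= \{ [\alpha_{0,A}], [\gamma_{0,B}] \mid A \in \mathcal{A}, B \in \mathcal{B} \}. \end{align*} Moreover, the composition in $\mathrm{Out}(G_3)$ is given, for $A,A' \in \mathcal{A}$ and $B,B' \in \mathcal{B}$, by \begin{align*} [\alpha_{0,A}]\circ[\alpha_{0,A'}] &= [\gamma_{0,AA'}], & [\alpha_{0,A}]\circ[\gamma_{0,B'}] &= [\alpha_{0,AB'}], \\ [\gamma_{0,B}]\circ[\alpha_{0,A'}] &= [\alpha_{0,BA'}], & [\gamma_{0,B}]\circ[\gamma_{0,B'}] &= [\gamma_{0,BB'}]. \end{align*}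
   Context: The group $G_3$ is $G_2 \rtimes_{\overline{\varphi}_2} \mathbb{Z}$, where $G_2 = \langle g_1, g_2 \mid g_2g_1=g_1^{-1}g_2\rangle$, $\varphi_2 \in \mathrm{Aut}(G_2)$ is given by $\varphi_2(g_1)=g_1^{-1}$, $\varphi_2(g_2)=g_1g_2$, and the generator $g_3$ of $\mathbb{Z}$ acts by $g_3 h g_3^{-1} = \varphi_2(h)$. Every element of $G_3$ is written uniquely as $g_1^{e_1}g_2^{e_2}g_3^{e_3}$ with $e_i \in \mathbb{Z}$. Matrix notation: a $3\times 3$ integer matrix $(a_{i,j})$ denotes the map $\varphi$ of $G_3$ determined on generators by $\varphi(g_j) = g_1^{a_{1,j}} g_2^{a_{2,j}} g_3^{a_{3,j}}$ for $j=1,2,3$ (the $j$-th column lists the exponents of the image of $g_j$). $I_2$ is the $2\times 2$ identity matrix. $\mathrm{Inn}(G)$ is the group of inner automorphisms, $\mathrm{Out}(G)=\mathrm{Aut}(G)/\mathrm{Inn}(G)$, and $[\varphi] = \mathrm{Inn}(G)\varphi$ is the class of $\varphi$ in $\mathrm{Out}(G)$. *)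

theory Defs
  imports "HOL-Analysis.Analysis" "HOL-Algebra.Bij" "HOL-Algebra.Coset"
begin

section \<open>Groups given by a presentation\<close>

text \<open>A word over the generators is a list of letters; the letter \<open>(x, True)\<close> stands for the
  generator \<open>x\<close> and \<open>(x, False)\<close> for its formal inverse. A pair \<open>(u, v)\<close> in the set \<open>R\<close> of
  relations stands for the relation \<open>u = v\<close>. All elements of the type \<open>'a\<close> are generators.\<close>

type_synonym 'a word = "('a \<times> bool) list"

inductive word_eq :: "('a word \<times> 'a word) set \<Rightarrow> 'a word \<Rightarrow> 'a word \<Rightarrow> bool"
  for R :: "('a word \<times> 'a word) set" where
  refl: "word_eq R u u"
| sym: "word_eq R u v \<Longrightarrow> word_eq R v u"
| trans: "word_eq R u v \<Longrightarrow> word_eq R v w \<Longrightarrow> word_eq R u w"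
| append: "word_eq R u v \<Longrightarrow> word_eq R u' v' \<Longrightarrow> word_eq R (u @ u') (v @ v')"
| cancel: "word_eq R [(x, b), (x, \<not> b)] []"
| relation: "(u, v) \<in> R \<Longrightarrow> word_eq R u v"

definition word_rel :: "('a word \<times> 'a word) set \<Rightarrow> ('a word \<times> 'a word) set" where
  "word_rel R = {(u, v). word_eq R u v}"

definition word_class :: "('a word \<times> 'a word) set \<Rightarrow> 'a word \<Rightarrow> 'a word set" where
  "word_class R u = word_rel R `` {u}"

definition presented_group :: "('a word \<times> 'a word) set \<Rightarrow> 'a word set monoid" where
  "presented_group R =
    \<lparr>carrier = UNIV // word_rel R,
     mult = (\<lambda>P Q. \<Union>u\<in>P. \<Union>v\<in>Q. word_class R (u @ v)),
     one = word_class R []\<rparr>"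

definition presented_gen :: "('a word \<times> 'a word) set \<Rightarrow> 'a \<Rightarrow> 'a word set" where
  "presented_gen R x = word_class R [(x, True)]"

lemma equiv_word_rel: "equiv UNIV (word_rel R)"
proof (intro equivI refl_onI symI transI)
  show "(u, u) \<in> word_rel R" for u
    by (simp add: word_rel_def word_eq.refl)
  show "(v, u) \<in> word_rel R" if "(u, v) \<in> word_rel R" for u v
    using that unfolding word_rel_def by (simp add: word_eq.sym)
  show "(u, w) \<in> word_rel R" if "(u, v) \<in> word_rel R" "(v, w) \<in> word_rel R" for u v w
    using that word_eq.trans[of R u v w] unfolding word_rel_def by simp
qed simp

lemma word_class_eq_iff: "word_class R u = word_class R v \<longleftrightarrow> word_eq R u v"
  unfolding word_class_def using eq_equiv_class_iff[OF equiv_word_rel, of u v R]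
  by (simp add: word_rel_def)

lemma carrier_presented_group: "carrier (presented_group R) = range (word_class R)"
  by (auto simp: presented_group_def word_class_def quotient_def)

lemma mult_presented_group:
  "word_class R u \<otimes>\<^bsub>presented_group R\<^esub> word_class R v = word_class R (u @ v)"
proof -
  have "word_class R (u' @ v') = word_class R (u @ v)"
    if "u' \<in> word_class R u" "v' \<in> word_class R v" for u' v'
  proof -
    have "word_eq R u u'" "word_eq R v v'"
      using that by (auto simp: word_class_def word_rel_def)
    then show ?thesis
      unfolding word_class_eq_iff by (rule word_eq.sym[OF word_eq.append])
  qed
  moreover have nonempty: "word_class R w \<noteq> {}" for w
    by (auto simp: word_class_def word_rel_def intro: word_eq.refl)
  ultimately have "(\<Union>u'\<in>word_class R u. \<Union>v'\<in>word_class R v. word_class R (u' @ v'))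
      = (\<Union>u'\<in>word_class R u. \<Union>v'\<in>word_class R v. word_class R (u @ v))"
    by (intro SUP_cong HOL.refl)
  also have "\<dots> = word_class R (u @ v)"
    using nonempty[of u] nonempty[of v] by simp
  finally show ?thesis by (simp add: presented_group_def)
qed

lemma one_presented_group: "\<one>\<^bsub>presented_group R\<^esub> = word_class R []"
  by (simp add: presented_group_def)

definition word_inv :: "'a word \<Rightarrow> 'a word" where
  "word_inv u = rev (map (\<lambda>(x, b). (x, \<not> b)) u)"

lemma word_eq_word_inv: "word_eq R (word_inv u @ u) []"
proof (induction u)
  case Nil
  show ?case by (simp add: word_inv_def word_eq.refl)
next
  case (Cons p u)
  obtain x b where p: "p = (x, b)" by (cases p)
  have "word_eq R (word_inv u @ [(x, \<not> b), (x, b)] @ u) (word_inv u @ [] @ u)"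
    using word_eq.cancel[of R x "\<not> b"] by (intro word_eq.append word_eq.refl) simp
  then have "word_eq R (word_inv (p # u) @ (p # u)) (word_inv u @ u)"
    by (simp add: word_inv_def p)
  then show ?case using Cons.IH by (rule word_eq.trans)
qed

lemma group_presented_group: "group (presented_group R)"
proof (rule groupI)
  show "\<exists>y\<in>carrier (presented_group R). y \<otimes>\<^bsub>presented_group R\<^esub> x = \<one>\<^bsub>presented_group R\<^esub>"
    if x: "x \<in> carrier (presented_group R)" for x
  proof -
    obtain u where "x = word_class R u" using x unfolding carrier_presented_group by blast
    then have *: "word_class R (word_inv u) \<otimes>\<^bsub>presented_group R\<^esub> x = \<one>\<^bsub>presented_group R\<^esub>"
      by (simp add: mult_presented_group one_presented_group word_class_eq_iff word_eq_word_inv)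
    show ?thesis
      using * by (intro bexI[of _ "word_class R (word_inv u)"]) (simp_all add: carrier_presented_group)
  qed
qed (auto simp: carrier_presented_group mult_presented_group one_presented_group)

definition word_eval :: "('b, 'c) monoid_scheme \<Rightarrow> ('a \<Rightarrow> 'b) \<Rightarrow> 'a word \<Rightarrow> 'b" where
  "word_eval H f w =
    foldr (\<lambda>(x, b) y. (if b then f x else inv\<^bsub>H\<^esub> f x) \<otimes>\<^bsub>H\<^esub> y) w \<one>\<^bsub>H\<^esub>"

lemma word_eval_closed:
  assumes "group H" "\<And>x. f x \<in> carrier H"
  shows "word_eval H f w \<in> carrier H"
proof -
  interpret H: group H by fact
  show ?thesis by (induction w) (auto simp: word_eval_def assms(2))
qed

lemma word_eval_append:
  assumes "group H" "\<And>x. f x \<in> carrier H"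
  shows "word_eval H f (u @ v) = word_eval H f u \<otimes>\<^bsub>H\<^esub> word_eval H f v"
proof (induction u)
  interpret H: group H by fact
  case Nil
  show ?case using word_eval_closed[of H f v] assms by (simp add: word_eval_def)
next
  interpret H: group H by fact
  case (Cons p u)
  have step: "word_eval H f (p # w) =
      (if snd p then f (fst p) else inv\<^bsub>H\<^esub> f (fst p)) \<otimes>\<^bsub>H\<^esub> word_eval H f w" for w
    by (simp add: word_eval_def split: prod.split)
  show ?case
    using Cons.IH by (simp add: step H.m_assoc assms word_eval_closed)
qed

lemma word_eq_imp_eval_eq:
  assumes "group H" "\<And>x. f x \<in> carrier H"
    and "\<And>u v. (u, v) \<in> R \<Longrightarrow> word_eval H f u = word_eval H f v"
    and "word_eq R u v"
  shows "word_eval H f u = word_eval H f v"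
proof -
  interpret H: group H by fact
  show ?thesis using assms(4)
  proof (induction rule: word_eq.induct)
    case (append u v u' v')
    then show ?case by (simp add: word_eval_append assms(1,2))
  next
    case (cancel x b)
    show ?case by (simp add: word_eval_def assms(2))
  qed (simp_all add: assms(3))
qed

theorem presented_group_universal:
  assumes "group H" "\<And>x. f x \<in> carrier H"
    and rel: "\<And>u v. (u, v) \<in> R \<Longrightarrow> word_eval H f u = word_eval H f v"
  shows "\<exists>!\<phi>. \<phi> \<in> hom (presented_group R) H \<and> \<phi> \<in> extensional (carrier (presented_group R)) \<and>
    (\<forall>x. \<phi> (presented_gen R x) = f x)"
proof -
  interpret H: group H by fact
  interpret G: group "presented_group R" by (rule group_presented_group)
  define \<phi> where "\<phi> = restrict (\<lambda>P. word_eval H f (SOME u. P = word_class R u)) (carrier (presented_group R))"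
  have \<phi>: "\<phi> (word_class R u) = word_eval H f u" for u
  proof -
    have "word_class R u = word_class R (SOME v. word_class R u = word_class R v)"
      by (rule someI_ex) blast
    then have "word_eq R u (SOME v. word_class R u = word_class R v)"
      unfolding word_class_eq_iff[symmetric] .
    from word_eq_imp_eval_eq[OF assms this] show ?thesis
      by (simp add: \<phi>_def carrier_presented_group)
  qed
  have carr: "word_class R u \<in> carrier (presented_group R)" for u
    by (simp add: carrier_presented_group)
  show ?thesis
  proof (rule ex1I[of _ \<phi>])
    show "\<phi> \<in> hom (presented_group R) H \<and> \<phi> \<in> extensional (carrier (presented_group R)) \<and>
      (\<forall>x. \<phi> (presented_gen R x) = f x)"
    proof (intro conjI allI)
      show "\<phi> \<in> hom (presented_group R) H"
        by (rule homI)
           (auto simp: carrier_presented_group mult_presented_group \<phi> word_eval_append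
              word_eval_closed assms(1,2))
      show "\<phi> \<in> extensional (carrier (presented_group R))"
        by (simp add: \<phi>_def)
      show "\<phi> (presented_gen R x) = f x" for x
        by (simp add: presented_gen_def \<phi> word_eval_def assms(2))
    qed
  next
    fix \<psi>
    assume \<psi>: "\<psi> \<in> hom (presented_group R) H \<and> \<psi> \<in> extensional (carrier (presented_group R)) \<and>
      (\<forall>x. \<psi> (presented_gen R x) = f x)"
    interpret hom: group_hom "presented_group R" H \<psi>
      by unfold_locales (use \<psi> in blast)
    have letter: "\<psi> (word_class R [(x, b)]) = (if b then f x else inv\<^bsub>H\<^esub> f x)" for x b
    proof (cases b)
      case True
      then show ?thesis using \<psi> by (simp add: presented_gen_def)
    next
      case False
      have "word_class R [(x, False)] \<otimes>\<^bsub>presented_group R\<^esub> word_class R [(x, True)] = \<one>\<^bsub>presented_group R\<^esub>"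
        using word_eq.cancel[of R x False]
        by (simp add: mult_presented_group one_presented_group word_class_eq_iff)
      then have "inv\<^bsub>presented_group R\<^esub> word_class R [(x, True)] = word_class R [(x, False)]"
        by (rule G.inv_equality) (rule carr)+
      then have "\<psi> (word_class R [(x, False)]) = inv\<^bsub>H\<^esub> \<psi> (word_class R [(x, True)])"
        using hom.hom_inv[OF carr, of "[(x, True)]"] by simp
      then show ?thesis using False \<psi> by (simp add: presented_gen_def)
    qed
    have "\<psi> (word_class R u) = word_eval H f u" for u
    proof (induction u)
      case Nil
      show ?case using hom.hom_one by (simp add: word_eval_def one_presented_group)
    next
      case (Cons p u)
      obtain x b where p: "p = (x, b)" by (cases p)
      have "\<psi> (word_class R (p # u)) = \<psi> (word_class R [p]) \<otimes>\<^bsub>H\<^esub> \<psi> (word_class R u)"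
        using hom.hom_mult[OF carr carr, of "[p]" u] by (simp add: mult_presented_group)
      then show ?case by (simp add: Cons.IH p letter word_eval_def)
    qed
    then show "\<psi> = \<phi>"
      using \<psi> by (intro extensionalityI[of _ "carrier (presented_group R)"])
        (auto simp: carrier_presented_group \<phi>, auto simp: \<phi>_def carrier_presented_group)
  qed
qed

section \<open>Inner and outer automorphisms\<close>

definition inner_auto :: "('a, 'b) monoid_scheme \<Rightarrow> ('a \<Rightarrow> 'a) set" where
  "inner_auto G = (\<lambda>g. \<lambda>h\<in>carrier G. g \<otimes>\<^bsub>G\<^esub> h \<otimes>\<^bsub>G\<^esub> inv\<^bsub>G\<^esub> g) ` carrier G"

definition Out :: "('a, 'b) monoid_scheme \<Rightarrow> ('a \<Rightarrow> 'a) set monoid" where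
  "Out G = AutoGroup G Mod inner_auto G"

definition out_class :: "('a, 'b) monoid_scheme \<Rightarrow> ('a \<Rightarrow> 'a) \<Rightarrow> ('a \<Rightarrow> 'a) set" where
  "out_class G \<phi> = inner_auto G #>\<^bsub>AutoGroup G\<^esub> \<phi>"

section \<open>The group \<open>G\<^sub>3\<close> and its automorphisms\<close>

text \<open>The generators and the matrix rows and columns are indexed by the three-element type \<open>3\<close>,
  whose elements are \<open>1\<close>, \<open>2\<close> and \<open>3\<close> (with \<open>3 = 0\<close>).\<close>

definition G3_relations :: "(3 word \<times> 3 word) set" where
  "G3_relations =
    {([(2, True), (1, True)], [(1, False), (2, True)]),
     ([(3, True), (1, True)], [(1, False), (3, True)]),
     ([(3, True), (2, True)], [(1, True), (2, True), (3, True)])}"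

definition G3 :: "3 word set monoid" where
  "G3 = presented_group G3_relations"

definition gen :: "3 \<Rightarrow> 3 word set" where
  "gen = presented_gen G3_relations"

text \<open>The endomorphism of \<open>G\<^sub>3\<close> denoted by a matrix. It is unspecified if the prescribed images
  of the generators do not extend to an endomorphism; there is at most one extension because
  the generators generate \<open>G\<^sub>3\<close> and the map is required to be extensional.\<close>

definition matrix_map :: "int^3^3 \<Rightarrow> 3 word set \<Rightarrow> 3 word set" where
  "matrix_map M = (THE \<phi>. \<phi> \<in> hom G3 G3 \<and> \<phi> \<in> extensional (carrier G3) \<and>
     (\<forall>j. \<phi> (gen j) = gen 1 [^]\<^bsub>G3\<^esub> (M $ 1 $ j) \<otimes>\<^bsub>G3\<^esub> gen 2 [^]\<^bsub>G3\<^esub> (M $ 2 $ j) \<otimes>\<^bsub>G3\<^esub> gen 3 [^]\<^bsub>G3\<^esub> (M $ 3 $ j)))"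

definition block_matrix :: "int \<Rightarrow> int \<Rightarrow> int \<Rightarrow> int^2^2 \<Rightarrow> int^3^3" where
  "block_matrix e a b A = vector
    [vector [e, a, b],
     vector [0, A $ 1 $ 1, A $ 1 $ 2],
     vector [0, A $ 2 $ 1, A $ 2 $ 2]]"

definition \<alpha> :: "int \<Rightarrow> int^2^2 \<Rightarrow> 3 word set \<Rightarrow> 3 word set" where
  "\<alpha> a A = matrix_map (block_matrix 1 a (a + 1) A)"

definition \<beta> :: "int \<Rightarrow> int^2^2 \<Rightarrow> 3 word set \<Rightarrow> 3 word set" where
  "\<beta> a A = matrix_map (block_matrix (- 1) a a A)"

definition \<gamma> :: "int \<Rightarrow> int^2^2 \<Rightarrow> 3 word set \<Rightarrow> 3 word set" where
  "\<gamma> a B = matrix_map (block_matrix 1 a a B)"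

definition \<delta> :: "int \<Rightarrow> int^2^2 \<Rightarrow> 3 word set \<Rightarrow> 3 word set" where
  "\<delta> a B = matrix_map (block_matrix (- 1) a (a - 1) B)"

text \<open>Over \<^typ>\<open>int\<close>, \<^const>\<open>invertible\<close> asks for an inverse with integer entries, so it expresses
  membership in \<open>GL(2, \<int>)\<close>.\<close>

definition \<A> :: "(int^2^2) set" where
  "\<A> = {A. invertible A \<and>
    (\<exists>k l m n. A = vector [vector [2 * k, 2 * m + 1], vector [2 * l + 1, 2 * n]])}"

definition \<B> :: "(int^2^2) set" where
  "\<B> = {B. invertible B \<and>
    (\<exists>k l m n. B = vector [vector [2 * k + 1, 2 * m], vector [2 * l, 2 * n + 1]])}"

end

theory Submission
  imports Defs "HOL-Algebra.Elementary_Groups"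
begin

text \<open>Writing elements in normal form identifies \<open>G\<^sub>3\<close> with \<open>\<int>\<^sup>3\<close> under an explicit multiplication,
  and \<open>ab\<close> sends \<open>g\<^sub>1\<^sup>a g\<^sub>2\<^sup>b g\<^sub>3\<^sup>c\<close> to \<open>(b, c) \<in> \<int>\<^sup>2\<close>. Since \<open>g\<^sub>1\<close> is a commutator, every
  endomorphism maps it to a power of \<open>g\<^sub>1\<close> and hence induces an integer matrix \<open>A\<close> on \<open>\<int>\<^sup>2\<close>; for an
  automorphism \<open>A\<close> is invertible and \<open>g\<^sub>1\<close> goes to \<open>g\<^sub>1\<^sup>\<plusminus>\<^sup>1\<close>. The first two relations make the column
  sums of \<open>A\<close> odd, so \<open>A\<close> is in \<open>\<A>\<close> or \<open>\<B>\<close>, and the third relation leaves exactly the listed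
  values of the remaining exponents. An automorphism inducing the identity matrix is
  conjugation by an explicit element, so \<open>Inn(G\<^sub>3)\<close> is the kernel of \<open>\<phi> \<mapsto> A\<close>: a class in
  \<open>Out(G\<^sub>3)\<close> is determined by its matrix, and classes compose as the matrices multiply.\<close>

section \<open>Normal forms in \<open>G\<^sub>3\<close>\<close>

text \<open>The two correction terms come from moving \<open>g\<^sub>2\<^sup>b g\<^sub>3\<^sup>c\<close> past \<open>g\<^sub>1\<close>, which it inverts iff \<open>b + c\<close>
  is odd, and \<open>g\<^sub>3\<^sup>c\<close> past \<open>g\<^sub>2\<^sup>b'\<close>, which produces a factor \<open>g\<^sub>1\<close> iff \<open>c\<close> and \<open>b'\<close> are both odd.\<close>

definition nf_mult :: "int \<times> int \<times> int \<Rightarrow> int \<times> int \<times> int \<Rightarrow> int \<times> int \<times> int" where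
  "nf_mult = (\<lambda>(a, b, c) (a', b', c').
     (a + (if even (b + c) then a' else - a')
        + (if odd c \<and> odd b' then (if even b then 1 else - 1) else 0), b + b', c + c'))"

lemma nf_mult_simp [simp]:
  "nf_mult (a, b, c) (a', b', c') =
     (a + (if even (b + c) then a' else - a')
        + (if odd c \<and> odd b' then (if even b then 1 else - 1) else 0), b + b', c + c')"
  by (simp add: nf_mult_def)

definition nf_group :: "(int \<times> int \<times> int) monoid" where
  "nf_group = \<lparr>carrier = UNIV, mult = nf_mult, one = (0, 0, 0)\<rparr>"

lemma nf_group_simps [simp]:
  "carrier nf_group = UNIV" "mult nf_group = nf_mult" "one nf_group = (0, 0, 0)"
  by (simp_all add: nf_group_def)

lemma group_nf_group: "group nf_group"
proof (rule groupI)
  show "x \<otimes>\<^bsub>nf_group\<^esub> y \<otimes>\<^bsub>nf_group\<^esub> z = x \<otimes>\<^bsub>nf_group\<^esub> (y \<otimes>\<^bsub>nf_group\<^esub> z)" for x y z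
    by (cases x; cases y; cases z) auto
next
  fix x :: "int \<times> int \<times> int"
  obtain a b c where x: "x = (a, b, c)" by (cases x)
  \<comment> \<open>This solves for a vanishing first coordinate of
    \<open>nf_mult (a', - b, - c) (a, b, c)\<close>; negation leaves the parities of
    \<open>b\<close> and \<open>c\<close> unchanged.\<close>
  define a' where "a' = (if odd c \<and> odd b then (if even b then - 1 else 1) else 0)
    - (if even (b + c) then a else - a)"
  show "\<exists>y\<in>carrier nf_group. y \<otimes>\<^bsub>nf_group\<^esub> x = \<one>\<^bsub>nf_group\<^esub>"
    by (intro bexI[of _ "(a', - b, - c)"]) (auto simp: x a'_def)
qed auto

interpretation H: group nf_group
  by (rule group_nf_group)

section \<open>The relations of \<open>G3\<close> and its universal property\<close>

interpretation G3: group G3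
  unfolding G3_def by (rule group_presented_group)

lemma gen_closed [simp]: "gen j \<in> carrier G3"
  by (simp add: gen_def G3_def presented_gen_def carrier_presented_group)

lemma gen_relations:
  "gen 2 \<otimes>\<^bsub>G3\<^esub> gen 1 = inv\<^bsub>G3\<^esub> gen 1 \<otimes>\<^bsub>G3\<^esub> gen 2"
  "gen 3 \<otimes>\<^bsub>G3\<^esub> gen 1 = inv\<^bsub>G3\<^esub> gen 1 \<otimes>\<^bsub>G3\<^esub> gen 3"
  "gen 3 \<otimes>\<^bsub>G3\<^esub> gen 2 = gen 1 \<otimes>\<^bsub>G3\<^esub> gen 2 \<otimes>\<^bsub>G3\<^esub> gen 3"
proof -
  let ?c = "word_class G3_relations"
  \<comment> \<open>The relations contain the formal letter \<open>(1, False)\<close>, which first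
    has to be identified with the group inverse of \<open>gen 1\<close>.\<close>
  have "?c [(1, False)] \<otimes>\<^bsub>G3\<^esub> gen 1 = \<one>\<^bsub>G3\<^esub>"
    using word_eq.cancel[of G3_relations 1 False]
    by (simp add: G3_def gen_def presented_gen_def mult_presented_group one_presented_group word_class_eq_iff)
  then have inv: "inv\<^bsub>G3\<^esub> gen 1 = ?c [(1, False)]"
    by (rule G3.inv_equality) (simp_all add: G3_def gen_def presented_gen_def carrier_presented_group)
  show
  "gen 2 \<otimes>\<^bsub>G3\<^esub> gen 1 = inv\<^bsub>G3\<^esub> gen 1 \<otimes>\<^bsub>G3\<^esub> gen 2"
  "gen 3 \<otimes>\<^bsub>G3\<^esub> gen 1 = inv\<^bsub>G3\<^esub> gen 1 \<otimes>\<^bsub>G3\<^esub> gen 3"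
  "gen 3 \<otimes>\<^bsub>G3\<^esub> gen 2 = gen 1 \<otimes>\<^bsub>G3\<^esub> gen 2 \<otimes>\<^bsub>G3\<^esub> gen 3"
    unfolding inv
    by (auto simp: G3_def gen_def presented_gen_def mult_presented_group word_class_eq_iff
        G3_relations_def intro!: word_eq.relation)
qed

text \<open>Von Dyck's theorem for this presentation. It serves twice: with \<open>nf_group\<close>
  as target it separates normal forms, with \<open>G3\<close> as target it constructs
  endomorphisms.\<close>

lemma G3_universal:
  assumes H: "group H" and f: "\<And>j. f j \<in> carrier H"
    and "f 2 \<otimes>\<^bsub>H\<^esub> f 1 = inv\<^bsub>H\<^esub> f 1 \<otimes>\<^bsub>H\<^esub> f 2"
    and "f 3 \<otimes>\<^bsub>H\<^esub> f 1 = inv\<^bsub>H\<^esub> f 1 \<otimes>\<^bsub>H\<^esub> f 3"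
    and "f 3 \<otimes>\<^bsub>H\<^esub> f 2 = f 1 \<otimes>\<^bsub>H\<^esub> f 2 \<otimes>\<^bsub>H\<^esub> f 3"
  shows "\<exists>!\<phi>. \<phi> \<in> hom G3 H \<and> \<phi> \<in> extensional (carrier G3) \<and> (\<forall>j. \<phi> (gen j) = f j)"
proof -
  interpret H: group H by fact
  show ?thesis unfolding G3_def gen_def
    by (rule presented_group_universal[OF H f])
      (auto simp: G3_relations_def word_eval_def f H.m_assoc[symmetric] assms(3-5))
qed

section \<open>Collecting words into normal form\<close>

definition nf :: "int \<times> int \<times> int \<Rightarrow> 3 word set" where
  "nf = (\<lambda>(a, b, c). gen 1 [^]\<^bsub>G3\<^esub> a \<otimes>\<^bsub>G3\<^esub> gen 2 [^]\<^bsub>G3\<^esub> b \<otimes>\<^bsub>G3\<^esub> gen 3 [^]\<^bsub>G3\<^esub> c)"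

lemma nf_eq: "nf (a, b, c) = gen 1 [^]\<^bsub>G3\<^esub> a \<otimes>\<^bsub>G3\<^esub> gen 2 [^]\<^bsub>G3\<^esub> b \<otimes>\<^bsub>G3\<^esub> gen 3 [^]\<^bsub>G3\<^esub> c"
  by (simp add: nf_def)

lemma nf_closed [simp]: "nf t \<in> carrier G3"
  by (cases t) (simp add: nf_eq)

lemma one_nf: "\<one>\<^bsub>G3\<^esub> = nf (0, 0, 0)"
  by (simp add: nf_eq)

text \<open>Conjugation by \<open>g\<close> is a homomorphism taking \<open>h\<close> to
  \<open>k\<close>, so it takes powers of \<open>h\<close> to powers of \<open>k\<close>.\<close>

lemma (in group) conj_int_pow:
  fixes n :: int
  assumes "g \<in> carrier G" "h \<in> carrier G" "k \<in> carrier G" "g \<otimes> h = k \<otimes> g"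
  shows "g \<otimes> h [^] n = k [^] n \<otimes> g"
proof -
  interpret c: group_hom G G "\<lambda>x. g \<otimes> x \<otimes> inv g"
    by unfold_locales (auto intro!: homI simp: assms m_assoc inv_solve_left)
  have "g \<otimes> h \<otimes> inv g = k"
    by (simp add: assms m_assoc)
  then have "g \<otimes> h [^] n \<otimes> inv g = k [^] n"
    using c.hom_int_pow[of h n] assms by simp
  then show ?thesis
    using assms by (metis int_pow_closed inv_closed inv_solve_right' m_closed)
qed

text \<open>Conjugation by g3 turns g2 into g1 g2. Since g2 inverts g1, the square of g1 g2 equals
  that of g2, so only the parity of \<open>n\<close> matters.\<close>

lemma gen3_gen2_pow:
  "gen 3 \<otimes>\<^bsub>G3\<^esub> gen 2 [^]\<^bsub>G3\<^esub> (n::int) =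
     (if even n then gen 2 [^]\<^bsub>G3\<^esub> n else gen 1 \<otimes>\<^bsub>G3\<^esub> gen 2 [^]\<^bsub>G3\<^esub> n) \<otimes>\<^bsub>G3\<^esub> gen 3"
proof -
  let ?xy = "gen 1 \<otimes>\<^bsub>G3\<^esub> gen 2"
  have conj: "gen 3 \<otimes>\<^bsub>G3\<^esub> gen 2 [^]\<^bsub>G3\<^esub> n = ?xy [^]\<^bsub>G3\<^esub> n \<otimes>\<^bsub>G3\<^esub> gen 3" for n :: int
    by (rule G3.conj_int_pow) (simp_all add: gen_relations)
  have "?xy \<otimes>\<^bsub>G3\<^esub> ?xy = gen 1 \<otimes>\<^bsub>G3\<^esub> (gen 2 \<otimes>\<^bsub>G3\<^esub> gen 1) \<otimes>\<^bsub>G3\<^esub> gen 2"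
    by (simp add: G3.m_assoc)
  also have "\<dots> = gen 2 \<otimes>\<^bsub>G3\<^esub> gen 2"
    by (simp add: gen_relations(1) G3.m_assoc[symmetric])
  finally have sq: "?xy [^]\<^bsub>G3\<^esub> (2::int) = gen 2 [^]\<^bsub>G3\<^esub> (2::int)"
    using G3.int_pow_mult[of ?xy 1 1] G3.int_pow_mult[of "gen 2" 1 1] by simp
  have even: "?xy [^]\<^bsub>G3\<^esub> (2 * k) = gen 2 [^]\<^bsub>G3\<^esub> (2 * k)" for k :: int
    using G3.int_pow_pow[of ?xy 2 k] G3.int_pow_pow[of "gen 2" 2 k] by (simp add: sq mult.commute)
  show ?thesis
  proof (cases "even n")
    case True
    then show ?thesis unfolding conj by (auto elim!: evenE simp: even)
  next
    case False
    then obtain k where n: "n = 2 * k + 1" by (rule oddE)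
    have "?xy [^]\<^bsub>G3\<^esub> n = ?xy \<otimes>\<^bsub>G3\<^esub> ?xy [^]\<^bsub>G3\<^esub> (2 * k)"
      using G3.int_pow_mult[of ?xy 1 "2 * k"] by (simp add: n add.commute)
    also have "\<dots> = gen 1 \<otimes>\<^bsub>G3\<^esub> (gen 2 \<otimes>\<^bsub>G3\<^esub> gen 2 [^]\<^bsub>G3\<^esub> (2 * k))"
      by (simp add: even G3.m_assoc)
    also have "gen 2 \<otimes>\<^bsub>G3\<^esub> gen 2 [^]\<^bsub>G3\<^esub> (2 * k) = gen 2 [^]\<^bsub>G3\<^esub> n"
      using G3.int_pow_mult[of "gen 2" 1 "2 * k"] by (simp add: n add.commute)
    finally show ?thesis using False by (simp add: conj)
  qed
qed

definition gen_exps :: "3 \<Rightarrow> int \<times> int \<times> int" where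
  "gen_exps j = (if j = 1 then (1, 0, 0) else if j = 2 then (0, 1, 0) else (0, 0, 1))"

lemma gen_exps_simps [simp]:
  "gen_exps 1 = (1, 0, 0)" "gen_exps 2 = (0, 1, 0)" "gen_exps 3 = (0, 0, 1)"
  by (simp_all add: gen_exps_def)

text \<open>A new letter is moved from the left to its place: g2 and g3 invert the power of g1 that
  they pass, and g3 leaves behind one g1 when it passes an odd power of g2.\<close>

lemma gen_mult_nf: "gen j \<otimes>\<^bsub>G3\<^esub> nf t = nf (nf_mult (gen_exps j) t)"
proof -
  obtain a b c where t: "t = (a, b, c)" by (cases t)
  let ?x = "gen 1" and ?y = "gen 2" and ?z = "gen 3"
  have succ: "gen i \<otimes>\<^bsub>G3\<^esub> gen i [^]\<^bsub>G3\<^esub> n = gen i [^]\<^bsub>G3\<^esub> (1 + n)" for i and n :: int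
    by (metis G3.int_pow_1 G3.int_pow_mult gen_closed)
  have flip: "gen i \<otimes>\<^bsub>G3\<^esub> ?x [^]\<^bsub>G3\<^esub> n = ?x [^]\<^bsub>G3\<^esub> (- n) \<otimes>\<^bsub>G3\<^esub> gen i"
    if "i = 2 \<or> i = 3" for i and n :: int
  proof -
    have "gen i \<otimes>\<^bsub>G3\<^esub> ?x [^]\<^bsub>G3\<^esub> n = (inv\<^bsub>G3\<^esub> ?x) [^]\<^bsub>G3\<^esub> n \<otimes>\<^bsub>G3\<^esub> gen i"
      using that by (intro G3.conj_int_pow) (auto simp: gen_relations)
    then show ?thesis by (simp add: G3.int_pow_inv G3.int_pow_neg)
  qed
  consider "j = 1" | "j = 2" | "j = 3" using exhaust_3[of j] by blast
  then show ?thesis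
  proof cases
    case 1
    then show ?thesis by (simp add: t nf_eq succ flip: G3.m_assoc)
  next
    case 2
    have "?y \<otimes>\<^bsub>G3\<^esub> nf t = (?y \<otimes>\<^bsub>G3\<^esub> ?x [^]\<^bsub>G3\<^esub> a) \<otimes>\<^bsub>G3\<^esub> ?y [^]\<^bsub>G3\<^esub> b \<otimes>\<^bsub>G3\<^esub> ?z [^]\<^bsub>G3\<^esub> c"
      by (simp add: t nf_eq G3.m_assoc)
    also have "\<dots> = ?x [^]\<^bsub>G3\<^esub> (- a) \<otimes>\<^bsub>G3\<^esub> (?y \<otimes>\<^bsub>G3\<^esub> ?y [^]\<^bsub>G3\<^esub> b) \<otimes>\<^bsub>G3\<^esub> ?z [^]\<^bsub>G3\<^esub> c"
      by (simp add: flip[of 2] G3.m_assoc)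
    finally show ?thesis by (simp add: 2 t nf_eq succ)
  next
    case 3
    have "?z \<otimes>\<^bsub>G3\<^esub> nf t = (?z \<otimes>\<^bsub>G3\<^esub> ?x [^]\<^bsub>G3\<^esub> a) \<otimes>\<^bsub>G3\<^esub> ?y [^]\<^bsub>G3\<^esub> b \<otimes>\<^bsub>G3\<^esub> ?z [^]\<^bsub>G3\<^esub> c"
      by (simp add: t nf_eq G3.m_assoc)
    also have "\<dots> = ?x [^]\<^bsub>G3\<^esub> (- a) \<otimes>\<^bsub>G3\<^esub> (?z \<otimes>\<^bsub>G3\<^esub> ?y [^]\<^bsub>G3\<^esub> b) \<otimes>\<^bsub>G3\<^esub> ?z [^]\<^bsub>G3\<^esub> c"
      by (simp add: flip[of 3] G3.m_assoc)
    also have "\<dots> = ?x [^]\<^bsub>G3\<^esub> (- a) \<otimes>\<^bsub>G3\<^esub> (if even b then ?y [^]\<^bsub>G3\<^esub> b else ?x \<otimes>\<^bsub>G3\<^esub> ?y [^]\<^bsub>G3\<^esub> b)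
        \<otimes>\<^bsub>G3\<^esub> (?z \<otimes>\<^bsub>G3\<^esub> ?z [^]\<^bsub>G3\<^esub> c)"
      by (simp add: gen3_gen2_pow G3.m_assoc)
    also have "\<dots> = ?x [^]\<^bsub>G3\<^esub> (- a + (if odd b then 1 else 0)) \<otimes>\<^bsub>G3\<^esub> ?y [^]\<^bsub>G3\<^esub> b
        \<otimes>\<^bsub>G3\<^esub> ?z [^]\<^bsub>G3\<^esub> (1 + c)"
    proof -
      have "?x [^]\<^bsub>G3\<^esub> (- a + 1) = ?x [^]\<^bsub>G3\<^esub> (- a) \<otimes>\<^bsub>G3\<^esub> ?x"
        by (metis G3.int_pow_1 G3.int_pow_mult gen_closed)
      then show ?thesis by (simp add: succ G3.m_assoc)
    qed
    finally show ?thesis by (simp add: 3 t nf_eq)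
  qed
qed

lemma inv_gen_mult_nf: "inv\<^bsub>G3\<^esub> gen j \<otimes>\<^bsub>G3\<^esub> nf t = nf (nf_mult (inv\<^bsub>nf_group\<^esub> gen_exps j) t)"
proof -
  have "nf_mult (gen_exps j) (nf_mult (inv\<^bsub>nf_group\<^esub> gen_exps j) t) = t"
    using H.m_assoc[of "gen_exps j" "inv\<^bsub>nf_group\<^esub> gen_exps j" t] H.r_inv[of "gen_exps j"]
      H.l_one[of t] by simp
  then have "nf t = gen j \<otimes>\<^bsub>G3\<^esub> nf (nf_mult (inv\<^bsub>nf_group\<^esub> gen_exps j) t)"
    by (simp add: gen_mult_nf)
  then show ?thesis by (simp add: G3.inv_solve_left' G3.m_assoc[symmetric])
qed

text \<open>The normal forms contain the identity and are closed under left multiplication by every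
  letter, so induction on words reaches all of \<open>G3\<close>.\<close>

lemma carrier_G3: "carrier G3 = range nf"
proof -
  have "word_class G3_relations w \<in> range nf" for w
  proof (induction w)
    case Nil
    have "word_class G3_relations [] = nf (0, 0, 0)"
      using one_nf by (simp add: G3_def one_presented_group)
    then show ?case by blast
  next
    case (Cons p w)
    obtain j b where p: "p = (j, b)" by (cases p)
    obtain t where t: "word_class G3_relations w = nf t" using Cons.IH by blast
    have T: "gen i = word_class G3_relations [(i, True)]" for i
      by (simp add: gen_def presented_gen_def)
    have "word_class G3_relations [(j, False)] \<otimes>\<^bsub>G3\<^esub> gen j = \<one>\<^bsub>G3\<^esub>"
      using word_eq.cancel[of G3_relations j False]
      by (simp add: G3_def T mult_presented_group one_presented_group word_class_eq_iff)
    then have F: "inv\<^bsub>G3\<^esub> gen j = word_class G3_relations [(j, False)]"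
      by (rule G3.inv_equality) (simp_all add: G3_def gen_def presented_gen_def carrier_presented_group)
    have "word_class G3_relations (p # w) = word_class G3_relations [p] \<otimes>\<^bsub>G3\<^esub> word_class G3_relations w"
      by (simp add: G3_def mult_presented_group)
    also have "\<dots> = (if b then gen j else inv\<^bsub>G3\<^esub> gen j) \<otimes>\<^bsub>G3\<^esub> nf t"
      by (cases b) (simp_all add: t p F flip: T)
    finally show ?case by (simp add: gen_mult_nf inv_gen_mult_nf)
  qed
  then show ?thesis
    using nf_closed by (auto simp: G3_def carrier_presented_group)
qed

section \<open>Uniqueness of normal forms and the product rule\<close>

lemma (in group) int_pow_hom_integer_group:
  assumes "f \<in> hom integer_group G"
  shows "f 1 [^] (n::int) = f n"
  using hom_int_pow[OF assms, of 1 n] by (simp add: is_group)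

lemma hom_eval_nf:
  assumes "group H" "\<phi> \<in> hom G3 H"
  shows "\<phi> (nf (a, b, c)) = \<phi> (gen 1) [^]\<^bsub>H\<^esub> a \<otimes>\<^bsub>H\<^esub> \<phi> (gen 2) [^]\<^bsub>H\<^esub> b \<otimes>\<^bsub>H\<^esub> \<phi> (gen 3) [^]\<^bsub>H\<^esub> c"
proof -
  interpret h: group_hom G3 H \<phi>
    by (intro group_hom.intro group_hom_axioms.intro assms G3.is_group)
  show ?thesis by (simp add: nf_eq h.hom_int_pow)
qed

lemma hom_G3_eqI:
  assumes "group H" "\<phi> \<in> hom G3 H" "\<psi> \<in> hom G3 H" and "\<And>j. \<phi> (gen j) = \<psi> (gen j)"
    and "g \<in> carrier G3"
  shows "\<phi> g = \<psi> g"
proof -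
  obtain a b c where "g = nf (a, b, c)" using assms(5) by (auto simp: carrier_G3)
  then show ?thesis by (simp add: hom_eval_nf[OF assms(1)] assms(2-4))
qed

text \<open>The coordinate triples satisfy the three relations in \<open>nf_group\<close>, so the
  universal property yields a homomorphism that reads off the exponents. As a left inverse of
  \<open>nf\<close> it makes normal forms unique.\<close>

lemma ex_exponents_hom: "\<exists>\<eta>\<in>hom G3 nf_group. \<forall>t. \<eta> (nf t) = t"
proof -
  have inv1: "inv\<^bsub>nf_group\<^esub> (1, 0, 0) = (- 1, 0, 0)"
    by (rule H.inv_equality) auto
  obtain \<eta> where \<eta>: "\<eta> \<in> hom G3 nf_group" "\<And>j. \<eta> (gen j) = gen_exps j"
    using G3_universal[OF group_nf_group, of gen_exps] by (auto simp: inv1)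
  have "(1, 0, 0) [^]\<^bsub>nf_group\<^esub> (n::int) = (n, 0, 0)" "(0, 1, 0) [^]\<^bsub>nf_group\<^esub> n = (0, n, 0)"
    "(0, 0, 1) [^]\<^bsub>nf_group\<^esub> n = (0, 0, n)" for n
    \<comment> \<open>Each coordinate axis is the image of a homomorphism from the integers, which
      gives the powers of the basis triples.\<close>
    using H.int_pow_hom_integer_group[of "\<lambda>n. (n, 0, 0)" n]
      H.int_pow_hom_integer_group[of "\<lambda>n. (0, n, 0)" n]
      H.int_pow_hom_integer_group[of "\<lambda>n. (0, 0, n)" n]
    by (auto simp: hom_def)
  then have "\<eta> (nf t) = t" for t
    by (cases t) (simp add: hom_eval_nf[OF group_nf_group] \<eta>)
  then show ?thesis using \<eta>(1) by blast
qed

lemma inj_nf: "nf s = nf t \<longleftrightarrow> s = t"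
  using ex_exponents_hom by metis

text \<open>General products need no further collection: the product is some \<open>nf u\<close>,
  and the exponent homomorphism determines \<open>u\<close>.\<close>

lemma nf_mult: "nf s \<otimes>\<^bsub>G3\<^esub> nf t = nf (nf_mult s t)"
proof -
  obtain \<eta> where \<eta>: "\<eta> \<in> hom G3 nf_group" "\<And>t. \<eta> (nf t) = t"
    using ex_exponents_hom by blast
  obtain u where u: "nf s \<otimes>\<^bsub>G3\<^esub> nf t = nf u"
    using G3.m_closed[OF nf_closed nf_closed, of s t] unfolding carrier_G3 by blast
  have "u = nf_mult s t"
    using hom_mult[OF \<eta>(1) nf_closed nf_closed, of s t] by (simp add: u \<eta>(2))
  with u show ?thesis by simp
qed

lemma gen_eq_nf: "gen 1 = nf (1, 0, 0)" "gen 2 = nf (0, 1, 0)" "gen 3 = nf (0, 0, 1)"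
  by (simp_all add: nf_eq)

lemma gen1_pow: "gen 1 [^]\<^bsub>G3\<^esub> (n::int) = nf (n, 0, 0)"
  by (simp add: nf_eq)

lemma inv_nf: "inv\<^bsub>G3\<^esub> nf (a, 0, 0) = nf (- a, 0, 0)"
  by (rule G3.inv_equality) (auto simp: nf_mult one_nf)


section \<open>The induced map on the abelianization modulo torsion\<close>

text \<open>A group record for addition, so that \<open>ab\<close> and multiplication by a matrix
  are homomorphisms that can be composed and compared on generators.\<close>

definition add_group :: "('a::ab_group_add) monoid" where
  "add_group = \<lparr>carrier = UNIV, mult = (+), one = 0\<rparr>"

lemma add_group_simps [simp]:
  "carrier add_group = UNIV" "mult add_group = (+)" "one add_group = 0"
  by (simp_all add: add_group_def)

lemma group_add_group: "group (add_group :: ('a::ab_group_add) monoid)"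
proof (rule groupI)
  show "\<exists>y\<in>carrier add_group. y \<otimes>\<^bsub>add_group\<^esub> x = \<one>\<^bsub>add_group\<^esub>" for x :: 'a
    by (intro bexI[of _ "- x"]) auto
qed (auto simp: add.assoc)

definition ab :: "3 word set \<Rightarrow> int^2" where
  "ab g = (case inv_into UNIV nf g of (a, b, c) \<Rightarrow> vector [b, c])"

lemma ab_nf [simp]: "ab (nf (a, b, c)) = vector [b, c]"
proof -
  have "inj nf" by (simp add: inj_def inj_nf)
  then show ?thesis by (simp add: ab_def)
qed

lemma vec2_eq_iff: "(u :: 'a^2) = v \<longleftrightarrow> u $ 1 = v $ 1 \<and> u $ 2 = v $ 2"
  by (simp add: vec_eq_iff forall_2)

lemma mat2_eq_iff: "(A :: 'a^2^2) = B \<longleftrightarrow>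
    A $ 1 $ 1 = B $ 1 $ 1 \<and> A $ 1 $ 2 = B $ 1 $ 2 \<and> A $ 2 $ 1 = B $ 2 $ 1 \<and> A $ 2 $ 2 = B $ 2 $ 2"
  by (auto simp: vec2_eq_iff)

lemma mat2_mult_vec: "(A :: int^2^2) *v v =
    vector [A $ 1 $ 1 * v $ 1 + A $ 1 $ 2 * v $ 2, A $ 2 $ 1 * v $ 1 + A $ 2 $ 2 * v $ 2]"
  by (simp add: vec2_eq_iff matrix_vector_mult_def sum_2)

lemma ab_hom: "ab \<in> hom G3 add_group"
  by (rule homI) (auto simp: carrier_G3 nf_mult vec2_eq_iff)

lemma in_carrier_ab:
  assumes "g \<in> carrier G3"
  obtains a where "g = nf (a, ab g $ 1, ab g $ 2)"
  using assms by (auto simp: carrier_G3)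

text \<open>Bijectivity is left out so that the property can be checked on generators. An
  automorphism is then the same as a map inducing some invertible matrix.\<close>

definition induces :: "(3 word set \<Rightarrow> 3 word set) \<Rightarrow> int^2^2 \<Rightarrow> bool" where
  "induces \<phi> A \<longleftrightarrow> \<phi> \<in> hom G3 G3 \<and> \<phi> \<in> extensional (carrier G3) \<and>
     (\<phi> (gen 1) = nf (1, 0, 0) \<or> \<phi> (gen 1) = nf (- 1, 0, 0)) \<and>
     (\<forall>g\<in>carrier G3. ab (\<phi> g) = A *v ab g)"

text \<open>In the commutative target of \<open>ab\<close>, the third relation cancels down to the
  vanishing of the image of g1, and the kernel of \<open>ab\<close> consists of the powers of
  g1.\<close>

lemma endo_gen1:
  assumes "\<phi> \<in> hom G3 G3"
  obtains e where "\<phi> (gen 1) = nf (e, 0, 0)"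
proof -
  have hom: "ab \<circ> \<phi> \<in> hom G3 add_group"
    using assms ab_hom by (rule hom_compose)
  have "ab (\<phi> (gen 3 \<otimes>\<^bsub>G3\<^esub> gen 2)) = ab (\<phi> (gen 1 \<otimes>\<^bsub>G3\<^esub> gen 2 \<otimes>\<^bsub>G3\<^esub> gen 3))"
    by (simp add: gen_relations)
  then have "ab (\<phi> (gen 1)) = 0"
    using hom_mult[OF hom] by simp
  moreover have "\<phi> (gen 1) \<in> carrier G3"
    using assms by (auto simp: hom_def)
  ultimately show ?thesis
    using in_carrier_ab[of "\<phi> (gen 1)"] that by auto
qed

lemma hom_gen1_power:
  assumes "\<phi> \<in> hom G3 G3" "\<phi> (gen 1) = nf (e, 0, 0)"
  shows "\<phi> (nf (n, 0, 0)) = nf (e * n, 0, 0)"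
proof -
  have "\<phi> (nf (n, 0, 0)) = \<phi> (gen 1 [^]\<^bsub>G3\<^esub> n)"
    by (simp only: gen1_pow)
  also have "\<dots> = (gen 1 [^]\<^bsub>G3\<^esub> e) [^]\<^bsub>G3\<^esub> n"
    using hom_int_pow[OF assms(1), of "gen 1" n] by (simp add: G3.is_group assms(2) gen1_pow)
  also have "\<dots> = nf (e * n, 0, 0)"
    using G3.int_pow_pow[of "gen 1" e n] by (simp only: gen_closed gen1_pow)
  finally show ?thesis .
qed

text \<open>Both sides are homomorphisms from \<open>G3\<close> to an additive group, so agreement
  on generators suffices; g1 goes to 0 on both sides.\<close>

lemma endo_linear:
  assumes \<phi>: "\<phi> \<in> hom G3 G3"
    and A: "ab (\<phi> (gen 2)) = vector [A $ 1 $ 1, A $ 2 $ 1]" "ab (\<phi> (gen 3)) = vector [A $ 1 $ 2, A $ 2 $ 2]"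
    and g: "g \<in> carrier G3"
  shows "ab (\<phi> g) = A *v ab g"
proof -
  have "(ab \<circ> \<phi>) g = ((\<lambda>v. A *v v) \<circ> ab) g"
  proof (rule hom_G3_eqI[OF group_add_group _ _ _ g])
    show "ab \<circ> \<phi> \<in> hom G3 add_group"
      using \<phi> ab_hom by (rule hom_compose)
    have "(\<lambda>v. A *v v) \<in> hom add_group add_group"
      by (rule homI) (simp_all add: matrix_vector_right_distrib)
    with ab_hom show "(\<lambda>v. A *v v) \<circ> ab \<in> hom G3 add_group"
      by (rule hom_compose)
    obtain e where "\<phi> (gen 1) = nf (e, 0, 0)" using \<phi> by (rule endo_gen1)
    then show "(ab \<circ> \<phi>) (gen j) = ((\<lambda>v. A *v v) \<circ> ab) (gen j)" for j
      using exhaust_3[of j] A by (auto simp: gen_eq_nf mat2_mult_vec vec2_eq_iff)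
  qed
  then show ?thesis by simp
qed

lemma induces_closed: "induces \<phi> A \<Longrightarrow> g \<in> carrier G3 \<Longrightarrow> \<phi> g \<in> carrier G3"
  by (auto simp: induces_def hom_def)

lemma induces_compose:
  assumes \<phi>: "induces \<phi> A" and \<psi>: "induces \<psi> B"
  shows "induces (compose (carrier G3) \<phi> \<psi>) (A ** B)"
  unfolding induces_def
proof (intro conjI ballI)
  show "compose (carrier G3) \<phi> \<psi> \<in> hom G3 G3"
    using \<phi> \<psi> by (auto simp: induces_def intro: G3.hom_compose)
  show "compose (carrier G3) \<phi> \<psi> (gen 1) = nf (1, 0, 0) \<or> compose (carrier G3) \<phi> \<psi> (gen 1) = nf (- 1, 0, 0)"
    using \<phi> \<psi> by (auto simp: induces_def compose_eq hom_gen1_power)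
  show "ab (compose (carrier G3) \<phi> \<psi> g) = A ** B *v ab g" if "g \<in> carrier G3" for g
    using \<phi> \<psi> that induces_closed[OF \<psi> that]
    by (simp add: induces_def compose_eq matrix_vector_mul_assoc)
qed simp

text \<open>\<open>ab\<close> maps g2 and g3 to the standard basis.\<close>

lemma linear_unique:
  assumes "\<And>g. g \<in> carrier G3 \<Longrightarrow> (A :: int^2^2) *v ab g = B *v ab g"
  shows "A = B"
  using assms[of "gen 2"] assms[of "gen 3"]
  by (simp add: gen_eq_nf mat2_mult_vec vec2_eq_iff mat2_eq_iff)

lemma induces_unique:
  assumes "induces \<phi> A" "induces \<phi> B"
  shows "A = B"
  using assms by (intro linear_unique) (metis induces_def)

lemma induces_id: "induces (\<lambda>g\<in>carrier G3. g) (mat 1)"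
  using G3.id_in_auto by (simp add: induces_def auto_def gen_eq_nf)

lemma induces_images:
  assumes "induces \<phi> A"
  obtains p q where "\<phi> (gen 2) = nf (p, A $ 1 $ 1, A $ 2 $ 1)" "\<phi> (gen 3) = nf (q, A $ 1 $ 2, A $ 2 $ 2)"
proof -
  have "ab (\<phi> (gen 2)) = vector [A $ 1 $ 1, A $ 2 $ 1]" "ab (\<phi> (gen 3)) = vector [A $ 1 $ 2, A $ 2 $ 2]"
    using assms by (simp_all add: induces_def) (simp_all add: gen_eq_nf mat2_mult_vec)
  then show ?thesis
    using that in_carrier_ab[of "\<phi> (gen 2)"] in_carrier_ab[of "\<phi> (gen 3)"] induces_closed[OF assms]
    by (metis gen_closed vector_2)
qed

lemma inv_into_auto:
  assumes "\<phi> \<in> auto G3"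
  obtains \<psi> where "\<psi> \<in> auto G3"
    "compose (carrier G3) \<phi> \<psi> = (\<lambda>g\<in>carrier G3. g)" "compose (carrier G3) \<psi> \<phi> = (\<lambda>g\<in>carrier G3. g)"
proof
  let ?\<psi> = "\<lambda>g\<in>carrier G3. inv_into (carrier G3) \<phi> g"
  have bij: "\<phi> \<in> Bij (carrier G3)" and hom: "\<phi> \<in> hom G3 G3"
    using assms by (auto simp: auto_def)
  show "?\<psi> \<in> auto G3"
    using bij hom by (simp add: auto_def restrict_inv_into_Bij G3.restrict_inv_into_hom)
  show "compose (carrier G3) ?\<psi> \<phi> = (\<lambda>g\<in>carrier G3. g)"
    using bij by (rule Bij_compose_restrict_eq)
  show "compose (carrier G3) \<phi> ?\<psi> = (\<lambda>g\<in>carrier G3. g)"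
    using bij by (auto simp: Bij_def compose_def bij_betw_def f_inv_into_f fun_eq_iff)
qed

text \<open>The matrices of \<open>\<phi>\<close> and of its inverse are inverse to each other.
  Likewise the exponents of g1 in the two images of g1 multiply to 1, so each is a sign.\<close>

lemma auto_induces:
  assumes "\<phi> \<in> auto G3"
  obtains A where "induces \<phi> A" "invertible A"
proof -
  obtain \<psi> where \<psi>: "\<psi> \<in> auto G3" "compose (carrier G3) \<phi> \<psi> = (\<lambda>g\<in>carrier G3. g)"
    "compose (carrier G3) \<psi> \<phi> = (\<lambda>g\<in>carrier G3. g)"
    using assms by (rule inv_into_auto)
  have hom: "\<phi> \<in> hom G3 G3" "\<psi> \<in> hom G3 G3"
    using assms \<psi>(1) by (auto simp: auto_def)
  have \<phi>\<psi>: "\<phi> (\<psi> g) = g" and \<psi>\<phi>: "\<psi> (\<phi> g) = g" if "g \<in> carrier G3" for g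
    using that fun_cong[OF \<psi>(2), of g] fun_cong[OF \<psi>(3), of g] by (simp_all add: compose_eq)
  have closed: "\<phi> g \<in> carrier G3" "\<psi> g \<in> carrier G3" if "g \<in> carrier G3" for g
    using hom that by (auto simp: hom_def)
  have "\<exists>A. \<forall>g\<in>carrier G3. ab (\<xi> g) = A *v ab g" if "\<xi> \<in> hom G3 G3" for \<xi>
  proof -
    define M :: "int^2^2" where "M = vector [vector [ab (\<xi> (gen 2)) $ 1, ab (\<xi> (gen 3)) $ 1],
        vector [ab (\<xi> (gen 2)) $ 2, ab (\<xi> (gen 3)) $ 2]]"
    have "ab (\<xi> g) = M *v ab g" if "g \<in> carrier G3" for g
      using \<open>\<xi> \<in> hom G3 G3\<close> _ _ that by (rule endo_linear) (simp_all add: M_def vec2_eq_iff)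
    then show ?thesis by blast
  qed
  then obtain A B where A: "\<And>g. g \<in> carrier G3 \<Longrightarrow> ab (\<phi> g) = A *v ab g"
    and B: "\<And>g. g \<in> carrier G3 \<Longrightarrow> ab (\<psi> g) = B *v ab g"
    using hom by meson
  have "A ** B = mat 1"
    by (intro linear_unique) (simp add: A[symmetric] B[symmetric] \<phi>\<psi> closed flip: matrix_vector_mul_assoc)
  moreover have "B ** A = mat 1"
    by (intro linear_unique) (simp add: A[symmetric] B[symmetric] \<psi>\<phi> closed flip: matrix_vector_mul_assoc)
  ultimately have inv: "invertible A"
    by (auto simp: invertible_def)
  obtain e where e: "\<phi> (gen 1) = nf (e, 0, 0)" using hom(1) by (rule endo_gen1)
  obtain e' where e': "\<psi> (gen 1) = nf (e', 0, 0)" using hom(2) by (rule endo_gen1)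
  have "nf (e * e', 0, 0) = nf (1, 0, 0)"
    using \<phi>\<psi>[of "gen 1"] by (simp add: e' hom_gen1_power[OF hom(1) e]) (simp add: gen_eq_nf)
  then have "e = 1 \<or> e = - 1"
    by (auto simp: inj_nf zmult_eq_1_iff)
  then have "induces \<phi> A"
    using e A assms by (auto simp: induces_def auto_def Bij_def)
  with inv show ?thesis using that by blast
qed

section \<open>Endomorphisms given by integer matrices\<close>

lemma matrix_map_eqI:
  assumes "\<phi> \<in> hom G3 G3" "\<phi> \<in> extensional (carrier G3)"
    and "\<And>j. \<phi> (gen j) = nf (M $ 1 $ j, M $ 2 $ j, M $ 3 $ j)"
  shows "matrix_map M = \<phi>"
  unfolding matrix_map_def nf_eq[symmetric]
proof (rule the_equality)
  show "\<phi> \<in> hom G3 G3 \<and> \<phi> \<in> extensional (carrier G3) \<and>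
    (\<forall>j. \<phi> (gen j) = nf (M $ 1 $ j, M $ 2 $ j, M $ 3 $ j))"
    using assms by blast
next
  fix \<psi>
  assume "\<psi> \<in> hom G3 G3 \<and> \<psi> \<in> extensional (carrier G3) \<and>
    (\<forall>j. \<psi> (gen j) = nf (M $ 1 $ j, M $ 2 $ j, M $ 3 $ j))"
  then have \<psi>: "\<psi> \<in> hom G3 G3" "\<psi> \<in> extensional (carrier G3)"
    "\<And>j. \<psi> (gen j) = \<phi> (gen j)"
    by (auto simp only: assms(3))
  show "\<psi> = \<phi>"
    using \<psi>(2) assms(2) hom_G3_eqI[OF G3.is_group \<psi>(1) assms(1) \<psi>(3)] by (rule extensionalityI)
qed

text \<open>The hypotheses say that the columns of the matrix satisfy the three defining relations.\<close>

lemma induces_block_matrix: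
  assumes e: "e = 1 \<or> e = - 1"
    and "odd (A $ 1 $ 1 + A $ 2 $ 1)" "odd (A $ 1 $ 2 + A $ 2 $ 2)"
    and "nf_mult (q, A $ 1 $ 2, A $ 2 $ 2) (p, A $ 1 $ 1, A $ 2 $ 1) =
      nf_mult (nf_mult (e, 0, 0) (p, A $ 1 $ 1, A $ 2 $ 1)) (q, A $ 1 $ 2, A $ 2 $ 2)"
  shows "induces (matrix_map (block_matrix e p q A)) A"
proof -
  let ?M = "block_matrix e p q A"
  let ?f = "\<lambda>j. nf (?M $ 1 $ j, ?M $ 2 $ j, ?M $ 3 $ j)"
  have f: "?f 1 = nf (e, 0, 0)" "?f 2 = nf (p, A $ 1 $ 1, A $ 2 $ 1)" "?f 3 = nf (q, A $ 1 $ 2, A $ 2 $ 2)"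
    by (simp_all add: block_matrix_def)
  have "\<exists>!\<phi>. \<phi> \<in> hom G3 G3 \<and> \<phi> \<in> extensional (carrier G3) \<and> (\<forall>j. \<phi> (gen j) = ?f j)"
    \<comment> \<open>The third relation is the last hypothesis verbatim, so \<open>nf_mult\<close>
      stays folded at first; the other two say that the images of g2 and g3 invert that of g1, which
      is the parity of the column sums.\<close>
    by (rule G3_universal[OF G3.is_group, of ?f], unfold f)
      (use assms in \<open>auto simp add: inv_nf nf_mult inj_nf simp del: nf_mult_simp\<close>, auto)
  then obtain \<phi> where \<phi>: "\<phi> \<in> hom G3 G3" "\<phi> \<in> extensional (carrier G3)" "\<And>j. \<phi> (gen j) = ?f j"
    by blast
  have "induces \<phi> A"
    unfolding induces_def
    using \<phi>(1,2) e endo_linear[OF \<phi>(1), of A] unfolding \<phi>(3) f by auto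
  then show ?thesis
    using matrix_map_eqI[of \<phi> ?M] \<phi> by simp
qed

text \<open>The defining relations are pushed through \<open>\<phi>\<close> and compared as normal
  forms. The images of g2 and g3 must invert a nontrivial power of g1, which forces odd column
  sums.\<close>

lemma induces_imp_block_matrix:
  assumes "induces \<phi> A"
  obtains e p q where "e = 1 \<or> e = - 1" "\<phi> = matrix_map (block_matrix e p q A)"
    "odd (A $ 1 $ 1 + A $ 2 $ 1)" "odd (A $ 1 $ 2 + A $ 2 $ 2)"
    "nf_mult (q, A $ 1 $ 2, A $ 2 $ 2) (p, A $ 1 $ 1, A $ 2 $ 1) =
      nf_mult (nf_mult (e, 0, 0) (p, A $ 1 $ 1, A $ 2 $ 1)) (q, A $ 1 $ 2, A $ 2 $ 2)"
proof -
  have hom: "\<phi> \<in> hom G3 G3" and ext: "\<phi> \<in> extensional (carrier G3)"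
    using assms by (auto simp: induces_def)
  interpret h: group_hom G3 G3 \<phi>
    by (intro group_hom.intro group_hom_axioms.intro hom G3.is_group)
  obtain e where e: "e = 1 \<or> e = - 1" "\<phi> (gen 1) = nf (e, 0, 0)"
    using assms by (auto simp: induces_def)
  obtain p q where pq: "\<phi> (gen 2) = nf (p, A $ 1 $ 1, A $ 2 $ 1)" "\<phi> (gen 3) = nf (q, A $ 1 $ 2, A $ 2 $ 2)"
    using assms by (rule induces_images)
  have "\<phi> = matrix_map (block_matrix e p q A)"
  proof (rule matrix_map_eqI[symmetric, OF hom ext])
    show "\<phi> (gen j) = nf (block_matrix e p q A $ 1 $ j, block_matrix e p q A $ 2 $ j, block_matrix e p q A $ 3 $ j)" for j
      using exhaust_3[of j] by (auto simp: e pq block_matrix_def)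
  qed
  moreover note rels = gen_relations[THEN arg_cong[of _ _ \<phi>]]
  note rels = rels[unfolded h.hom_mult[OF gen_closed gen_closed]
      h.hom_mult[OF G3.inv_closed[OF gen_closed] gen_closed]
      h.hom_mult[OF G3.m_closed[OF gen_closed gen_closed] gen_closed]
      h.hom_inv[OF gen_closed] e(2) pq inv_nf nf_mult inj_nf]
  moreover have "odd (A $ 1 $ 1 + A $ 2 $ 1)" "odd (A $ 1 $ 2 + A $ 2 $ 2)"
    using rels(1,2) e(1) by (auto split: if_splits)
  ultimately show ?thesis
    using that[OF e(1)] by metis
qed

section \<open>Inner automorphisms\<close>

lemma (in group) conj_in_auto:
  assumes "g \<in> carrier G"
  shows "(\<lambda>h\<in>carrier G. g \<otimes> h \<otimes> inv g) \<in> auto G"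
proof -
  have cancel: "g \<otimes> (inv g \<otimes> h) = h" "inv g \<otimes> (g \<otimes> h) = h" if "h \<in> carrier G" for h
    using that assms by (simp_all flip: m_assoc)
  have "bij_betw (\<lambda>h. g \<otimes> h \<otimes> inv g) (carrier G) (carrier G)"
    by (rule bij_betw_byWitness[of _ "\<lambda>h. inv g \<otimes> h \<otimes> g"])
      (auto simp: assms m_assoc cancel)
  moreover have "(\<lambda>h\<in>carrier G. g \<otimes> h \<otimes> inv g) \<in> hom G G"
    by (rule homI) (simp_all add: assms m_assoc cancel)
  ultimately show ?thesis
    by (simp add: auto_def Bij_def cong: bij_betw_cong)
qed

text \<open>Moving the inverse to the other side avoids computing inverses of normal forms.\<close>

lemma conj_eqI:
  assumes "nf_mult s t = nf_mult u s"
  shows "nf s \<otimes>\<^bsub>G3\<^esub> nf t \<otimes>\<^bsub>G3\<^esub> inv\<^bsub>G3\<^esub> nf s = nf u"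
proof -
  have "nf s \<otimes>\<^bsub>G3\<^esub> nf t = nf u \<otimes>\<^bsub>G3\<^esub> nf s"
    by (simp only: nf_mult assms)
  then show ?thesis by (simp add: G3.m_assoc)
qed

text \<open>Conjugation is trivial after \<open>ab\<close>, whose target is commutative, and it
  fixes or inverts g1 according to the parity of \<open>b + c\<close>.\<close>

lemma conj_induces_1: "induces (\<lambda>h\<in>carrier G3. nf s \<otimes>\<^bsub>G3\<^esub> h \<otimes>\<^bsub>G3\<^esub> inv\<^bsub>G3\<^esub> nf s) (mat 1)"
proof -
  obtain k b c where s: "s = (k, b, c)" by (cases s)
  let ?\<phi> = "\<lambda>h\<in>carrier G3. nf s \<otimes>\<^bsub>G3\<^esub> h \<otimes>\<^bsub>G3\<^esub> inv\<^bsub>G3\<^esub> nf s"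
  have "?\<phi> (gen 1) = nf (if even (b + c) then 1 else - 1, 0, 0)"
    by (simp add: gen_eq_nf conj_eqI s)
  moreover have "ab (?\<phi> g) = ab g" if "g \<in> carrier G3" for g
  proof -
    have "ab (?\<phi> g) + ab (nf s) = ab (?\<phi> g \<otimes>\<^bsub>G3\<^esub> nf s)"
      using hom_mult[OF ab_hom, of "?\<phi> g" "nf s"] that by simp
    also have "?\<phi> g \<otimes>\<^bsub>G3\<^esub> nf s = nf s \<otimes>\<^bsub>G3\<^esub> g"
      using that by (simp add: G3.m_assoc)
    also have "ab (nf s \<otimes>\<^bsub>G3\<^esub> g) = ab (nf s) + ab g"
      using hom_mult[OF ab_hom, of "nf s" g] that by simp
    finally show ?thesis by simp
  qed
  ultimately show ?thesis
    using G3.conj_in_auto[of "nf s"] by (auto simp: induces_def auto_def)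
qed

text \<open>The third relation reads \<open>2 * q = 2 * p + e - 1\<close>, so \<open>e\<close> and
  \<open>p\<close> determine the map; every such pair comes from a conjugation.\<close>

lemma induces_1_imp_inner:
  assumes \<phi>: "induces \<phi> (mat 1)"
  shows "\<phi> \<in> inner_auto G3"
proof -
  obtain e p q where e: "e = 1 \<or> e = - 1" and block: "\<phi> = matrix_map (block_matrix e p q (mat 1))"
    and rel: "nf_mult (q, 0, 1) (p, 1, 0) = nf_mult (nf_mult (e, 0, 0) (p, 1, 0)) (q, 0, 1)"
    using \<phi> by (rule induces_imp_block_matrix) (simp add: mat_def)
  text \<open>The pairs \<open>(e, parity of p)\<close> correspond to the four classes of the conjugating element
    modulo the subgroup generated by \<open>g\<^sub>1\<close> and the central elements \<open>g\<^sub>2\<^sup>2\<close>, \<open>g\<^sub>3\<^sup>2\<close>.\<close>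
  have "\<exists>s. nf_mult s (1, 0, 0) = nf_mult (e, 0, 0) s \<and> nf_mult s (0, 1, 0) = nf_mult (p, 1, 0) s \<and>
      nf_mult s (0, 0, 1) = nf_mult (q, 0, 1) s"
  proof (cases "even p")
    case True
    then obtain k where "p = 2 * k" by (rule evenE)
    with rel e show ?thesis
      \<comment> \<open>Conjugation by the k-th power of g1 adds \<open>2 * k\<close> to the
        g1-exponent in the image of g2; a factor g2 fixes g2 and inverts g1.\<close>
      by (intro exI[of _ "(k, if e = 1 then 0 else 1, 0)"]) auto
  next
    case False
    then obtain k where "p = 2 * k + 1" by (rule oddE)
    with rel e show ?thesis
      \<comment> \<open>Conjugation by g3 sends g2 to g1 g2, while g2 g3 sends it to the product of
        the inverse of g1 with g2. The second case starts from exponent -1, hence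
        \<open>k + 1\<close>.\<close>
      by (intro exI[of _ "if e = 1 then (k + 1, 1, 1) else (k, 0, 1)"]) auto
  qed
  then obtain s where s: "nf_mult s (1, 0, 0) = nf_mult (e, 0, 0) s"
    "nf_mult s (0, 1, 0) = nf_mult (p, 1, 0) s" "nf_mult s (0, 0, 1) = nf_mult (q, 0, 1) s"
    by blast
  let ?c = "\<lambda>h\<in>carrier G3. nf s \<otimes>\<^bsub>G3\<^esub> h \<otimes>\<^bsub>G3\<^esub> inv\<^bsub>G3\<^esub> nf s"
  have "matrix_map (block_matrix e p q (mat 1)) = ?c"
  proof (rule matrix_map_eqI)
    show "?c \<in> hom G3 G3"
      using G3.conj_in_auto[of "nf s"] by (simp add: auto_def)
    show "?c (gen j) = nf (block_matrix e p q (mat 1) $ 1 $ j, block_matrix e p q (mat 1) $ 2 $ j,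
        block_matrix e p q (mat 1) $ 3 $ j)" for j
      using exhaust_3[of j] s
      by (auto simp: block_matrix_def mat_def gen_eq_nf conj_eqI simp del: nf_mult_simp)
  qed simp
  then show ?thesis
    by (auto simp: block inner_auto_def)
qed

lemma inner_auto_G3: "inner_auto G3 = {\<phi>. induces \<phi> (mat 1)}"
  using induces_1_imp_inner conj_induces_1 by (auto simp: inner_auto_def carrier_G3)

section \<open>The automorphism group\<close>

lemma mem_\<A>: "A \<in> \<A> \<longleftrightarrow> invertible A \<and>
    even (A $ 1 $ 1) \<and> odd (A $ 1 $ 2) \<and> odd (A $ 2 $ 1) \<and> even (A $ 2 $ 2)"
  by (auto simp: \<A>_def mat2_eq_iff elim!: evenE oddE) presburger+

lemma mem_\<B>: "B \<in> \<B> \<longleftrightarrow> invertible B \<and>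
    odd (B $ 1 $ 1) \<and> even (B $ 1 $ 2) \<and> even (B $ 2 $ 1) \<and> odd (B $ 2 $ 2)"
  by (auto simp: \<B>_def mat2_eq_iff elim!: evenE oddE) presburger+

lemma mat2_mult_nth: "((A :: int^2^2) ** B) $ i $ j = A $ i $ 1 * B $ 1 $ j + A $ i $ 2 * B $ 2 $ j"
  by (simp add: matrix_matrix_mult_def sum_2)

text \<open>Modulo 2 the members of \<open>\<A>\<close> become the swap matrix and those of
  \<open>\<B>\<close> the identity, so the four product rules are those of a group of order
  two.\<close>

lemma \<A>_mult_\<A>: "A \<in> \<A> \<Longrightarrow> A' \<in> \<A> \<Longrightarrow> A ** A' \<in> \<B>"
  unfolding mem_\<A> mem_\<B> mat2_mult_nth even_add even_mult_iff by (simp only: invertible_mult) simp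

lemma \<A>_mult_\<B>: "A \<in> \<A> \<Longrightarrow> B' \<in> \<B> \<Longrightarrow> A ** B' \<in> \<A>"
  unfolding mem_\<A> mem_\<B> mat2_mult_nth even_add even_mult_iff by (simp only: invertible_mult) simp

lemma \<B>_mult_\<A>: "B \<in> \<B> \<Longrightarrow> A' \<in> \<A> \<Longrightarrow> B ** A' \<in> \<A>"
  unfolding mem_\<A> mem_\<B> mat2_mult_nth even_add even_mult_iff by (simp only: invertible_mult) simp

lemma \<B>_mult_\<B>: "B \<in> \<B> \<Longrightarrow> B' \<in> \<B> \<Longrightarrow> B ** B' \<in> \<B>"
  unfolding mem_\<A> mem_\<B> mat2_mult_nth even_add even_mult_iff by (simp only: invertible_mult) simp

lemma mat_1_mem_\<B>: "mat 1 \<in> \<B>"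
proof -
  have "invertible (mat 1 :: int^2^2)"
    by (auto simp: invertible_def)
  then show ?thesis
    unfolding mem_\<B> by (simp add: mat_def)
qed

text \<open>Odd column sums make each column a unit vector modulo 2. Equal columns would leave a row
  of even entries, but each row pairs to 1 with a column of the inverse.\<close>

lemma invertible_mat2_parity:
  assumes "invertible (A :: int^2^2)" "odd (A $ 1 $ 1 + A $ 2 $ 1)" "odd (A $ 1 $ 2 + A $ 2 $ 2)"
  shows "A \<in> \<A> \<union> \<B>"
proof -
  obtain B where "A ** B = mat 1" using assms(1) by (auto simp: invertible_def)
  then have "A $ 1 $ 1 * B $ 1 $ 1 + A $ 1 $ 2 * B $ 2 $ 1 = 1"
    "A $ 2 $ 1 * B $ 1 $ 2 + A $ 2 $ 2 * B $ 2 $ 2 = 1"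
    by (simp_all add: mat_def flip: mat2_mult_nth)
  then have "odd (A $ 1 $ 1 * B $ 1 $ 1 + A $ 1 $ 2 * B $ 2 $ 1)"
    "odd (A $ 2 $ 1 * B $ 1 $ 2 + A $ 2 $ 2 * B $ 2 $ 2)"
    by simp_all
  then show ?thesis using assms by (auto simp: mem_\<A> mem_\<B>)
qed

section \<open>Automorphisms inducing a given matrix\<close>

lemma induces_\<A>_iff:
  assumes "A \<in> \<A>"
  shows "induces \<phi> A \<longleftrightarrow> (\<exists>a. \<phi> = \<alpha> a A \<or> \<phi> = \<beta> a A)"
proof
  assume "induces \<phi> A"
  then obtain e p q where e: "e = 1 \<or> e = - 1" and \<phi>: "\<phi> = matrix_map (block_matrix e p q A)"
    and rel: "nf_mult (q, A $ 1 $ 2, A $ 2 $ 2) (p, A $ 1 $ 1, A $ 2 $ 1) =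
      nf_mult (nf_mult (e, 0, 0) (p, A $ 1 $ 1, A $ 2 $ 1)) (q, A $ 1 $ 2, A $ 2 $ 2)"
    by (rule induces_imp_block_matrix)
  \<comment> \<open>For these parities the first coordinates of \<open>rel\<close> give
    \<open>2 * q = 2 * p + e + 1\<close>.\<close>
  have "e = 1 \<and> q = p + 1 \<or> e = - 1 \<and> q = p"
    using e rel assms by (auto simp: mem_\<A>)
  then show "\<exists>a. \<phi> = \<alpha> a A \<or> \<phi> = \<beta> a A"
    by (auto simp: \<phi> \<alpha>_def \<beta>_def)
next
  assume "\<exists>a. \<phi> = \<alpha> a A \<or> \<phi> = \<beta> a A"
  then show "induces \<phi> A"
    using assms by (auto simp: \<alpha>_def \<beta>_def mem_\<A> intro!: induces_block_matrix)
qed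

lemma induces_\<B>_iff:
  assumes "B \<in> \<B>"
  shows "induces \<phi> B \<longleftrightarrow> (\<exists>a. \<phi> = \<gamma> a B \<or> \<phi> = \<delta> a B)"
proof
  assume "induces \<phi> B"
  then obtain e p q where e: "e = 1 \<or> e = - 1" and \<phi>: "\<phi> = matrix_map (block_matrix e p q B)"
    and rel: "nf_mult (q, B $ 1 $ 2, B $ 2 $ 2) (p, B $ 1 $ 1, B $ 2 $ 1) =
      nf_mult (nf_mult (e, 0, 0) (p, B $ 1 $ 1, B $ 2 $ 1)) (q, B $ 1 $ 2, B $ 2 $ 2)"
    by (rule induces_imp_block_matrix)
  \<comment> \<open>Here the first coordinates of \<open>rel\<close> give
    \<open>2 * q = 2 * p + e - 1\<close>.\<close>
  have "e = 1 \<and> q = p \<or> e = - 1 \<and> q = p - 1"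
    using e rel assms by (auto simp: mem_\<B>)
  then show "\<exists>a. \<phi> = \<gamma> a B \<or> \<phi> = \<delta> a B"
    by (auto simp: \<phi> \<gamma>_def \<delta>_def)
next
  assume "\<exists>a. \<phi> = \<gamma> a B \<or> \<phi> = \<delta> a B"
  then show "induces \<phi> B"
    using assms by (auto simp: \<gamma>_def \<delta>_def mem_\<B> intro!: induces_block_matrix)
qed

lemma induces_\<alpha>: "A \<in> \<A> \<Longrightarrow> induces (\<alpha> a A) A"
  using induces_\<A>_iff by blast

lemma induces_\<gamma>: "B \<in> \<B> \<Longrightarrow> induces (\<gamma> a B) B"
  using induces_\<B>_iff by blast

text \<open>For some \<open>\<psi>\<close> inducing the inverse matrix, both composites with
  \<open>\<phi>\<close> induce the identity matrix and hence are inner. Being bijective, they make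
  \<open>\<phi>\<close> injective and surjective.\<close>

lemma induces_invertible_imp_auto:
  assumes \<phi>: "induces \<phi> A" and "invertible A"
  shows "\<phi> \<in> auto G3"
proof -
  obtain B where B: "A ** B = mat 1" "B ** A = mat 1"
    using assms(2) by (auto simp: invertible_def)
  have "A \<in> \<A> \<union> \<B>"
    using \<phi> by (rule induces_imp_block_matrix) (rule invertible_mat2_parity[OF assms(2)])
  \<comment> \<open>Some \<open>\<psi>\<close> exists once \<open>B\<close> lies in
    \<open>\<A>\<close> or \<open>\<B>\<close>; the product \<open>A ** B = mat 1\<close> read
    modulo 2 supplies the parities of \<open>B\<close>.\<close>
  have eqs: "A $ i $ 1 * B $ 1 $ j + A $ i $ 2 * B $ 2 $ j = mat 1 $ i $ j" for i j
    by (simp add: B flip: mat2_mult_nth)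
  have "odd (B $ 1 $ 1 + B $ 2 $ 1)" "odd (B $ 1 $ 2 + B $ 2 $ 2)"
    using \<open>A \<in> \<A> \<union> \<B>\<close> eqs[of 1 1, THEN arg_cong[of _ _ even]] eqs[of 1 2, THEN arg_cong[of _ _ even]]
      eqs[of 2 1, THEN arg_cong[of _ _ even]] eqs[of 2 2, THEN arg_cong[of _ _ even]]
    by (auto simp: mem_\<A> mem_\<B> mat_def)
  moreover have "invertible B" using B by (auto simp: invertible_def)
  ultimately have "B \<in> \<A> \<union> \<B>" by (intro invertible_mat2_parity)
  then obtain \<psi> where \<psi>: "induces \<psi> B"
    using induces_\<alpha> induces_\<gamma> by blast
  have "compose (carrier G3) \<phi> \<psi> \<in> inner_auto G3" "compose (carrier G3) \<psi> \<phi> \<in> inner_auto G3"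
    using induces_compose[OF \<phi> \<psi>] induces_compose[OF \<psi> \<phi>] by (simp_all add: B inner_auto_G3)
  then have bij: "bij_betw (compose (carrier G3) \<phi> \<psi>) (carrier G3) (carrier G3)"
    "bij_betw (compose (carrier G3) \<psi> \<phi>) (carrier G3) (carrier G3)"
    using G3.conj_in_auto by (auto simp: inner_auto_def auto_def Bij_def)
  have closed: "\<phi> g \<in> carrier G3" "\<psi> g \<in> carrier G3" if "g \<in> carrier G3" for g
    using that induces_closed \<phi> \<psi> by auto
  have "inj_on \<phi> (carrier G3)"
    using bij_betw_imp_inj_on[OF bij(2)] by (auto simp: inj_on_def compose_eq)
  moreover have "\<phi> ` carrier G3 = carrier G3"
  proof
    show "\<phi> ` carrier G3 \<subseteq> carrier G3" using closed by auto
    show "carrier G3 \<subseteq> \<phi> ` carrier G3"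
    proof
      fix g assume "g \<in> carrier G3"
      then have "g \<in> compose (carrier G3) \<phi> \<psi> ` carrier G3"
        by (simp add: bij_betw_imp_surj_on[OF bij(1)])
      then show "g \<in> \<phi> ` carrier G3" using closed by (auto simp: compose_eq)
    qed
  qed
  ultimately show ?thesis
    using \<phi> by (simp add: auto_def Bij_def bij_betw_def induces_def)
qed

lemma auto_G3: "auto G3 = {\<phi>. \<exists>A\<in>\<A> \<union> \<B>. induces \<phi> A}"
proof -
  have "\<exists>A\<in>\<A> \<union> \<B>. induces \<phi> A" if "\<phi> \<in> auto G3" for \<phi>
  proof -
    obtain A where A: "induces \<phi> A" "invertible A" using \<open>\<phi> \<in> auto G3\<close> by (rule auto_induces)
    have "A \<in> \<A> \<union> \<B>"
      using A(1) by (rule induces_imp_block_matrix) (rule invertible_mat2_parity[OF A(2)])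
    with A(1) show ?thesis by blast
  qed
  moreover have "\<phi> \<in> auto G3" if "A \<in> \<A> \<union> \<B>" "induces \<phi> A" for \<phi> A
    using that by (auto intro: induces_invertible_imp_auto simp: mem_\<A> mem_\<B>)
  ultimately show ?thesis by blast
qed

section \<open>The outer automorphism group\<close>

interpretation Aut: group "AutoGroup G3"
  by (rule G3.AutoGroup)

lemma carrier_AutoGroup [simp]: "carrier (AutoGroup G3) = auto G3"
  by (simp add: AutoGroup_def)

lemma one_AutoGroup: "\<one>\<^bsub>AutoGroup G3\<^esub> = (\<lambda>g\<in>carrier G3. g)"
  by (simp add: AutoGroup_def BijGroup_def)

lemma induces_mult:
  assumes "\<phi> \<in> auto G3" "\<psi> \<in> auto G3" "induces \<phi> A" "induces \<psi> B"
  shows "induces (\<phi> \<otimes>\<^bsub>AutoGroup G3\<^esub> \<psi>) (A ** B)"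
  using assms induces_compose by (simp add: AutoGroup_def BijGroup_def auto_def)

lemma induces_inv:
  assumes "\<phi> \<in> auto G3" "induces \<phi> A"
  obtains B where "induces (inv\<^bsub>AutoGroup G3\<^esub> \<phi>) B" "A ** B = mat 1"
proof -
  have inv: "inv\<^bsub>AutoGroup G3\<^esub> \<phi> \<in> auto G3"
    using Aut.inv_closed[of \<phi>] assms(1) by simp
  then obtain B where B: "induces (inv\<^bsub>AutoGroup G3\<^esub> \<phi>) B" by (rule auto_induces)
  have "induces \<one>\<^bsub>AutoGroup G3\<^esub> (A ** B)"
    using induces_mult[OF assms(1) inv assms(2) B] Aut.r_inv[of \<phi>] assms(1) by simp
  then have "A ** B = mat 1"
    using induces_id by (auto simp: one_AutoGroup intro: induces_unique)
  with B show ?thesis using that by blast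
qed

text \<open>Inner automorphisms are those inducing the identity matrix, and matrices multiply under
  composition, so this is normality of a kernel.\<close>

lemma inner_auto_normal: "inner_auto G3 \<lhd> AutoGroup G3"
proof -
  have sub: "\<phi> \<in> auto G3" if "induces \<phi> (mat 1)" for \<phi>
    using that mat_1_mem_\<B> by (auto simp: auto_G3)
  have "subgroup (inner_auto G3) (AutoGroup G3)"
  proof (rule Aut.subgroupI)
    show "inner_auto G3 \<noteq> {}"
      using induces_id by (auto simp: inner_auto_G3)
    show "inv\<^bsub>AutoGroup G3\<^esub> \<phi> \<in> inner_auto G3" if "\<phi> \<in> inner_auto G3" for \<phi>
      using that induces_inv[of \<phi> "mat 1"] sub by (auto simp: inner_auto_G3)
    show "\<phi> \<otimes>\<^bsub>AutoGroup G3\<^esub> \<psi> \<in> inner_auto G3"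
      if "\<phi> \<in> inner_auto G3" "\<psi> \<in> inner_auto G3" for \<phi> \<psi>
      using that induces_mult[of \<phi> \<psi> "mat 1" "mat 1"] sub by (simp add: inner_auto_G3)
  qed (use sub in \<open>auto simp: inner_auto_G3\<close>)
  moreover have "\<phi> \<otimes>\<^bsub>AutoGroup G3\<^esub> h \<otimes>\<^bsub>AutoGroup G3\<^esub> inv\<^bsub>AutoGroup G3\<^esub> \<phi> \<in> inner_auto G3"
    if \<phi>: "\<phi> \<in> auto G3" and "h \<in> inner_auto G3" for \<phi> h
  proof -
    obtain A where A: "induces \<phi> A" using \<phi> by (rule auto_induces)
    obtain B where B: "induces (inv\<^bsub>AutoGroup G3\<^esub> \<phi>) B" "A ** B = mat 1"
      using \<phi> A by (rule induces_inv)
    have h: "induces h (mat 1)" "h \<in> auto G3"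
      using that sub by (auto simp: inner_auto_G3)
    have "induces (\<phi> \<otimes>\<^bsub>AutoGroup G3\<^esub> h) A"
      using induces_mult[OF \<phi> h(2) A h(1)] by simp
    then have "induces (\<phi> \<otimes>\<^bsub>AutoGroup G3\<^esub> h \<otimes>\<^bsub>AutoGroup G3\<^esub> inv\<^bsub>AutoGroup G3\<^esub> \<phi>) (A ** B)"
      using Aut.inv_closed[of \<phi>] Aut.m_closed[of \<phi> h] \<phi> h(2) B(1) by (intro induces_mult) simp_all
    then show ?thesis by (simp add: B(2) inner_auto_G3)
  qed
  ultimately show ?thesis by (simp add: Aut.normal_inv_iff)
qed

interpretation Inn: normal "inner_auto G3" "AutoGroup G3"
  by (rule inner_auto_normal)

text \<open>The product of \<open>\<psi>\<close> with the inverse of \<open>\<phi>\<close> induces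
  the identity matrix, so it is inner and the two cosets coincide.\<close>

lemma out_class_eqI:
  assumes "\<phi> \<in> auto G3" "\<psi> \<in> auto G3" "induces \<phi> A" "induces \<psi> A"
  shows "out_class G3 \<phi> = out_class G3 \<psi>"
proof -
  obtain B where B: "induces (inv\<^bsub>AutoGroup G3\<^esub> \<phi>) B" "A ** B = mat 1"
    using assms(1,3) by (rule induces_inv)
  have inv: "inv\<^bsub>AutoGroup G3\<^esub> \<phi> \<in> auto G3"
    using Aut.inv_closed[of \<phi>] assms(1) by simp
  have "\<psi> \<otimes>\<^bsub>AutoGroup G3\<^esub> inv\<^bsub>AutoGroup G3\<^esub> \<phi> \<in> inner_auto G3"
    using induces_mult[OF assms(2) inv assms(4) B(1)] by (simp add: B(2) inner_auto_G3)
  then have "(\<psi> \<otimes>\<^bsub>AutoGroup G3\<^esub> inv\<^bsub>AutoGroup G3\<^esub> \<phi>) \<otimes>\<^bsub>AutoGroup G3\<^esub> \<phi> \<in> inner_auto G3 #>\<^bsub>AutoGroup G3\<^esub> \<phi>"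
    using Aut.rcosI Inn.subset assms(1) by simp
  then have "\<psi> \<in> inner_auto G3 #>\<^bsub>AutoGroup G3\<^esub> \<phi>"
    using assms(1,2) inv by (simp add: Aut.m_assoc)
  then show ?thesis
    unfolding out_class_def using assms(1) Inn.is_subgroup by (intro Aut.repr_independence) simp_all
qed

text \<open>A representative of the product class only has to induce the product matrix, so
  composites need not be computed.\<close>

lemma out_class_mult:
  assumes "\<phi> \<in> auto G3" "\<psi> \<in> auto G3" "\<theta> \<in> auto G3"
    and "induces \<phi> A" "induces \<psi> B" "induces \<theta> (A ** B)"
  shows "out_class G3 \<phi> \<otimes>\<^bsub>Out G3\<^esub> out_class G3 \<psi> = out_class G3 \<theta>"
proof -
  have "out_class G3 \<phi> \<otimes>\<^bsub>Out G3\<^esub> out_class G3 \<psi> = out_class G3 (\<phi> \<otimes>\<^bsub>AutoGroup G3\<^esub> \<psi>)"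
    using assms by (simp add: Out_def out_class_def Inn.rcos_sum)
  also have "\<dots> = out_class G3 \<theta>"
    using assms induces_mult Aut.m_closed[of \<phi> \<psi>] by (intro out_class_eqI[where A = "A ** B"]) simp_all
  finally show ?thesis .
qed

lemma \<alpha>_auto: "A \<in> \<A> \<Longrightarrow> \<alpha> a A \<in> auto G3"
  unfolding auto_G3 using induces_\<alpha> by blast

lemma \<gamma>_auto: "B \<in> \<B> \<Longrightarrow> \<gamma> a B \<in> auto G3"
  unfolding auto_G3 using induces_\<gamma> by blast

lemma carrier_Out_G3: "carrier (Out G3) = out_class G3 ` auto G3"
  by (simp add: Out_def carrier_FactGroup out_class_def[abs_def])

theorem theorem4p3:
  shows "auto G3 =
      {\<alpha> a A | a A. A \<in> \<A>} \<union> {\<beta> a A | a A. A \<in> \<A>} \<union>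
      {\<gamma> a B | a B. B \<in> \<B>} \<union> {\<delta> a B | a B. B \<in> \<B>}
    \<and> inner_auto G3 = {\<gamma> a (mat 1) | a. True} \<union> {\<delta> a (mat 1) | a. True}
    \<and> carrier (Out G3) =
      {out_class G3 (\<alpha> 0 A) | A. A \<in> \<A>} \<union> {out_class G3 (\<gamma> 0 B) | B. B \<in> \<B>}
    \<and> (\<forall>A\<in>\<A>. \<forall>A'\<in>\<A>. out_class G3 (\<alpha> 0 A) \<otimes>\<^bsub>Out G3\<^esub> out_class G3 (\<alpha> 0 A')
        = out_class G3 (\<gamma> 0 (A ** A')))
    \<and> (\<forall>A\<in>\<A>. \<forall>B'\<in>\<B>. out_class G3 (\<alpha> 0 A) \<otimes>\<^bsub>Out G3\<^esub> out_class G3 (\<gamma> 0 B')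
        = out_class G3 (\<alpha> 0 (A ** B')))
    \<and> (\<forall>B\<in>\<B>. \<forall>A'\<in>\<A>. out_class G3 (\<gamma> 0 B) \<otimes>\<^bsub>Out G3\<^esub> out_class G3 (\<alpha> 0 A')
        = out_class G3 (\<alpha> 0 (B ** A')))
    \<and> (\<forall>B\<in>\<B>. \<forall>B'\<in>\<B>. out_class G3 (\<gamma> 0 B) \<otimes>\<^bsub>Out G3\<^esub> out_class G3 (\<gamma> 0 B')
        = out_class G3 (\<gamma> 0 (B ** B')))"
proof (intro conjI ballI)
  show "auto G3 = {\<alpha> a A | a A. A \<in> \<A>} \<union> {\<beta> a A | a A. A \<in> \<A>} \<union>
      {\<gamma> a B | a B. B \<in> \<B>} \<union> {\<delta> a B | a B. B \<in> \<B>}"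
    unfolding auto_G3 bex_Un by (auto simp: induces_\<A>_iff induces_\<B>_iff cong: bex_cong)
  show "inner_auto G3 = {\<gamma> a (mat 1) | a. True} \<union> {\<delta> a (mat 1) | a. True}"
    unfolding inner_auto_G3 induces_\<B>_iff[OF mat_1_mem_\<B>] by auto
  show "carrier (Out G3) =
      {out_class G3 (\<alpha> 0 A) | A. A \<in> \<A>} \<union> {out_class G3 (\<gamma> 0 B) | B. B \<in> \<B>}" (is "_ = ?R")
  proof
    \<comment> \<open>The class depends only on the induced matrix, so the representative with
      first-row parameter 0 and sign 1 can be chosen.\<close>
    have "out_class G3 \<phi> \<in> ?R" if \<phi>: "\<phi> \<in> auto G3" for \<phi>
    proof -
      obtain A where A: "A \<in> \<A> \<or> A \<in> \<B>" "induces \<phi> A" using \<phi> unfolding auto_G3 by blast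
      from A(1) show ?thesis
      proof
        assume "A \<in> \<A>"
        then show ?thesis
          using out_class_eqI[OF \<phi> \<alpha>_auto A(2) induces_\<alpha>] by blast
      next
        assume "A \<in> \<B>"
        then show ?thesis
          using out_class_eqI[OF \<phi> \<gamma>_auto A(2) induces_\<gamma>] by blast
      qed
    qed
    then show "carrier (Out G3) \<subseteq> ?R" unfolding carrier_Out_G3 by blast
    show "?R \<subseteq> carrier (Out G3)"
      unfolding carrier_Out_G3 using \<alpha>_auto \<gamma>_auto by blast
  qed
  \<comment> \<open>The automorphisms themselves may differ: with \<open>A\<close> and
    \<open>A'\<close> both the swap matrix, the composite is \<open>\<gamma> 1 (mat 1)\<close>. Only
    the classes agree.\<close>
  show "out_class G3 (\<alpha> 0 A) \<otimes>\<^bsub>Out G3\<^esub> out_class G3 (\<alpha> 0 A') = out_class G3 (\<gamma> 0 (A ** A'))"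
    if "A \<in> \<A>" "A' \<in> \<A>" for A A'
    by (rule out_class_mult[OF \<alpha>_auto \<alpha>_auto \<gamma>_auto induces_\<alpha> induces_\<alpha> induces_\<gamma>])
      (simp_all add: that \<A>_mult_\<A>)
  show "out_class G3 (\<alpha> 0 A) \<otimes>\<^bsub>Out G3\<^esub> out_class G3 (\<gamma> 0 B') = out_class G3 (\<alpha> 0 (A ** B'))"
    if "A \<in> \<A>" "B' \<in> \<B>" for A B'
    by (rule out_class_mult[OF \<alpha>_auto \<gamma>_auto \<alpha>_auto induces_\<alpha> induces_\<gamma> induces_\<alpha>])
      (simp_all add: that \<A>_mult_\<B>)
  show "out_class G3 (\<gamma> 0 B) \<otimes>\<^bsub>Out G3\<^esub> out_class G3 (\<alpha> 0 A') = out_class G3 (\<alpha> 0 (B ** A'))"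
    if "B \<in> \<B>" "A' \<in> \<A>" for B A'
    by (rule out_class_mult[OF \<gamma>_auto \<alpha>_auto \<alpha>_auto induces_\<gamma> induces_\<alpha> induces_\<alpha>])
      (simp_all add: that \<B>_mult_\<A>)
  show "out_class G3 (\<gamma> 0 B) \<otimes>\<^bsub>Out G3\<^esub> out_class G3 (\<gamma> 0 B') = out_class G3 (\<gamma> 0 (B ** B'))"
    if "B \<in> \<B>" "B' \<in> \<B>" for B B'
    by (rule out_class_mult[OF \<gamma>_auto \<gamma>_auto \<gamma>_auto induces_\<gamma> induces_\<gamma> induces_\<gamma>])
      (simp_all add: that \<B>_mult_\<B>)
qed

end
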